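(* Let $J:\mathbb{R}\to[0,\infty)$ be smooth, radially symmetric (even), with $\int_{\mathbb{R}}J=1$ and supported in $(-d,d)$, $d>0$. The stationary problem $$J*\phi=\phi\ \text{ for }x\ge0,\qquad \phi=0\ \text{ for }-d<x<0,\qquad (\phi(x)-x)\in L^\infty(\mathbb{R}_+)$$ has a solution $\phi$ such that $$x\le\phi(x)\le x+d\qquad\text{for }x\ge0.$$
   Context: $\mathbb{R}_+=(0,\infty)$. "Supported in $(-d,d)$" means $J(z)=0$ for $|z|\ge d$. A solution is a measurable function $\phi:(-d,\infty)\to\mathbb{R}$; for $x\ge0$, $J*\phi(x)=\int J(x-y)\phi(y)\,dy$ only involves values of $\phi$ on $(-d,\infty)$. *)

theory Defs
  imports "HOL-Analysis.Analysis"
begin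

definition smooth :: "(real \<Rightarrow> real) \<Rightarrow> bool" where
  "smooth f \<longleftrightarrow> (\<forall>n. ((deriv ^^ n) f) differentiable_on UNIV)"

definition Linfty :: "real set \<Rightarrow> (real \<Rightarrow> real) \<Rightarrow> bool" where
  "Linfty S f \<longleftrightarrow> f \<in> borel_measurable (lebesgue_on S) \<and>
     (\<exists>C. AE x in lebesgue_on S. \<bar>f x\<bar> \<le> C)"

(* The convolution is over the domain S of \<phi>: for S = (-d, \<infinity>), J supported in (-d, d) and
   x \<ge> 0, this is the whole integral over the reals, whatever extension of \<phi> is chosen. *)
definition conv_on :: "real set \<Rightarrow> (real \<Rightarrow> real) \<Rightarrow> (real \<Rightarrow> real) \<Rightarrow> real \<Rightarrow> real" where
  "conv_on S J \<phi> x = integral\<^sup>L (lebesgue_on S) (\<lambda>y. J (x - y) * \<phi> y)"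

(* A function on (-d, \<infinity>) is represented by a total function whose values outside (-d, \<infinity>) are
   irrelevant. Integrability is stated explicitly because the Bochner integral of a
   non-integrable function is 0 by convention. *)
definition stationary_solution :: "real \<Rightarrow> (real \<Rightarrow> real) \<Rightarrow> (real \<Rightarrow> real) \<Rightarrow> bool" where
  "stationary_solution d J \<phi> \<longleftrightarrow>
     \<phi> \<in> borel_measurable (lebesgue_on {-d<..}) \<and>
     (\<forall>x\<ge>0. integrable (lebesgue_on {-d<..}) (\<lambda>y. J (x - y) * \<phi> y) \<and>
             conv_on {-d<..} J \<phi> x = \<phi> x) \<and>
     (\<forall>x. -d < x \<and> x < 0 \<longrightarrow> \<phi> x = 0) \<and>
     Linfty {0<..} (\<lambda>x. \<phi> x - x)"

end

theory Submission
  imports Defs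
begin

text \<open>
  The solution is a monotone limit of iterates between two barriers. Let
  \<open>T f\<close> be \<open>J * f\<close> on the closed half line \<open>x \<ge> 0\<close> and \<open>0\<close> on the negative axis; a solution is a
  fixed point of \<open>T\<close>. As \<open>J\<close> is even with unit mass, its first moment vanishes and convolution with
  \<open>J\<close> reproduces every function \<open>y + c\<close> (lemma \<open>conv_shift\<close>). This makes the positive part of \<open>x\<close> a
  subsolution, because it dominates \<open>x\<close> and agrees with \<open>x\<close> for \<open>x \<ge> 0\<close>. It also makes the function
  equal to \<open>x + d\<close> for \<open>x \<ge> 0\<close> and to \<open>0\<close> for \<open>x < 0\<close> a supersolution: when \<open>x \<ge> 0\<close> the kernel sees
  only points \<open>y > -d\<close>, and there this function is at most \<open>y + d\<close>.

  Since \<open>J \<ge> 0\<close>, the operator \<open>T\<close> is monotone. It therefore maps the functions between the two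
  barriers to themselves (lemma \<open>between_halfline_conv\<close>), and its iterates from the lower barrier
  increase. They are bounded by the upper barrier, so they converge pointwise, and dominated
  convergence on the bounded window seen by the kernel shows that the limit is fixed by \<open>T\<close>.
\<close>

section \<open>Convolution with a symmetric kernel of unit mass\<close>

locale symmetric_kernel =
  fixes J :: "real \<Rightarrow> real" and d :: real
  assumes d_pos: "d > 0"
    and nonneg: "J z \<ge> 0"
    and even: "J (- z) = J z"
    and borel [measurable]: "J \<in> borel_measurable borel"
    and integrable: "integrable lborel J"
    and mass: "integral\<^sup>L lborel J = 1"
    and support: "\<bar>z\<bar> \<ge> d \<Longrightarrow> J z = 0"
begin

definition conv :: "(real \<Rightarrow> real) \<Rightarrow> real \<Rightarrow> real" where
  "conv f x = (LINT y|lborel. J (x - y) * f y)"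

lemma integrable_reflect: "integrable lborel (\<lambda>y. J (x - y))"
  using lborel_integrable_real_affine[OF integrable, of "-1" x] by simp

lemma integral_reflect: "(LINT y|lborel. J (x - y)) = 1"
  using lborel_integral_real_affine[of "-1" J x] mass by simp

text \<open>
  On the window \<open>|x - y| < d\<close> a function of linear growth is bounded by a constant, so a multiple of
  the translated kernel is an integrable majorant.
\<close>

lemma kernel_mult_bound:
  assumes "\<And>y. \<bar>f y\<bar> \<le> \<bar>y\<bar> + a"
  shows "\<bar>J (x - y) * f y\<bar> \<le> J (x - y) * (\<bar>x\<bar> + d + a)"
proof (cases "\<bar>x - y\<bar> \<ge> d")
  case True
  then show ?thesis using support by simp
next
  case False
  then have "\<bar>f y\<bar> \<le> \<bar>x\<bar> + d + a" using assms[of y] by linarith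
  then show ?thesis using nonneg[of "x - y"] by (simp add: abs_mult mult_left_mono)
qed

lemma integrable_conv:
  assumes [measurable]: "f \<in> borel_measurable borel"
    and "\<And>y. \<bar>f y\<bar> \<le> \<bar>y\<bar> + a"
  shows "integrable lborel (\<lambda>y. J (x - y) * f y)"
proof (rule Bochner_Integration.integrable_bound)
  show "integrable lborel (\<lambda>y. J (x - y) * (\<bar>x\<bar> + d + a))"
    using integrable_reflect by simp
  show "AE y in lborel. norm (J (x - y) * f y) \<le> norm (J (x - y) * (\<bar>x\<bar> + d + a))"
    using kernel_mult_bound[OF assms(2)] by (intro AE_I2) (metis abs_ge_self order_trans real_norm_def)
qed measurable

lemma conv_mono:
  assumes "f \<in> borel_measurable borel" "\<And>y. \<bar>f y\<bar> \<le> \<bar>y\<bar> + a"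
    and "g \<in> borel_measurable borel" "\<And>y. \<bar>g y\<bar> \<le> \<bar>y\<bar> + b"
    and le: "\<And>y. \<bar>x - y\<bar> < d \<Longrightarrow> f y \<le> g y"
  shows "conv f x \<le> conv g x"
  unfolding conv_def
proof (rule integral_mono)
  show "J (x - y) * f y \<le> J (x - y) * g y" for y
    using le[of y] support[of "x - y"] nonneg[of "x - y"]
    by (cases "\<bar>x - y\<bar> < d") (auto intro: mult_left_mono)
qed (use assms integrable_conv in blast)+

lemma borel_measurable_conv:
  assumes [measurable]: "f \<in> borel_measurable borel"
  shows "conv f \<in> borel_measurable borel"
  unfolding conv_def by measurable

text \<open>The mean of \<open>y\<close> under the translated kernel is \<open>x\<close>, because the odd function \<open>z J z\<close> has
  integral zero.\<close>

lemma conv_shift: "conv (\<lambda>y. y + c) x = x + c"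
proof -
  have lin: "integrable lborel (\<lambda>y. J (x - y) * (y + c))"
    by (rule integrable_conv[where a = "\<bar>c\<bar>"]) auto
  have odd: "(LINT z|lborel. J z * z) = 0"
    using lborel_integral_real_affine[of "-1" "\<lambda>z. J z * z" 0] by (simp add: even)
  have "(LINT y|lborel. J (x - y) * (x - y)) = 0"
    using lborel_integral_real_affine[of "-1" "\<lambda>z. J z * z" x] odd by simp
  moreover have "J (x - y) * (x - y) = J (x - y) * (x + c) - J (x - y) * (y + c)" for y
    by (simp add: algebra_simps)
  ultimately have "(LINT y|lborel. J (x - y) * (x + c)) - conv (\<lambda>y. y + c) x = 0"
    using lin integrable_reflect by (simp add: conv_def)
  then show ?thesis by (simp add: integral_reflect)
qed

section \<open>Barriers and monotone iteration\<close>

definition halfline_conv :: "(real \<Rightarrow> real) \<Rightarrow> real \<Rightarrow> real" where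
  "halfline_conv f x = (if x \<ge> 0 then conv f x else 0)"

definition lower :: "real \<Rightarrow> real" where
  "lower x = max x 0"

definition upper :: "real \<Rightarrow> real" where
  "upper x = (if x \<ge> 0 then x + d else 0)"

definition between :: "(real \<Rightarrow> real) \<Rightarrow> bool" where
  "between f \<longleftrightarrow> f \<in> borel_measurable borel \<and> (\<forall>x. lower x \<le> f x \<and> f x \<le> upper x)"

lemma between_growth: "between f \<Longrightarrow> \<bar>f y\<bar> \<le> \<bar>y\<bar> + d"
  using d_pos unfolding between_def lower_def upper_def
  by (smt (verit, best))

lemma between_lower: "between lower"
proof -
  have "lower \<in> borel_measurable borel" unfolding lower_def by measurable
  then show ?thesis using d_pos by (auto simp: between_def lower_def upper_def)
qed

text \<open>
  Both bounds compare with the exactly reproduced functions \<open>y\<close> and \<open>y + d\<close>. The upper one uses that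
  the window of a point \<open>x \<ge> 0\<close> lies in \<open>y > -d\<close>, where \<open>y + d\<close> is positive.
\<close>

lemma between_halfline_conv:
  assumes f: "between f"
  shows "between (halfline_conv f)"
proof -
  have meas [measurable]: "f \<in> borel_measurable borel" using f by (simp add: between_def)
  have bounds: "max y 0 \<le> f y" "f y \<le> upper y" for y
    using f by (auto simp: between_def lower_def)
  have "halfline_conv f \<in> borel_measurable borel"
    using borel_measurable_conv[OF meas] unfolding halfline_conv_def by measurable
  moreover have conv: "x \<le> conv f x" "conv f x \<le> x + d" if "x \<ge> 0" for x
  proof -
    have "conv (\<lambda>y. y + 0) x \<le> conv f x"
      by (rule conv_mono[where a = 0 and b = d])
         (use bounds(1) between_growth[OF f] in auto)
    then show "x \<le> conv f x" by (simp only: conv_shift)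
    have "f y \<le> y + d" if "\<bar>x - y\<bar> < d" for y
      using bounds(2)[of y] that \<open>x \<ge> 0\<close> by (auto simp: upper_def split: if_splits)
    then have "conv f x \<le> conv (\<lambda>y. y + d) x"
      by (intro conv_mono[where a = d and b = d])
         (use meas between_growth[OF f] d_pos in auto)
    then show "conv f x \<le> x + d" by (simp only: conv_shift)
  qed
  moreover have "0 \<le> conv f x" if "x \<ge> 0" for x
    using conv(1)[OF that] that by linarith
  ultimately show ?thesis
    by (simp add: between_def lower_def upper_def halfline_conv_def)
qed

lemma halfline_conv_mono:
  assumes "between f" "between g" "\<And>y. f y \<le> g y"
  shows "halfline_conv f x \<le> halfline_conv g x"
  using conv_mono[of f d g d x] assms between_growth
  by (auto simp: halfline_conv_def between_def)

lemma halfline_conv_tendsto: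
  assumes u: "\<And>n. between (u n)" and f: "between f"
    and lim: "\<And>y. (\<lambda>n. u n y) \<longlonglongrightarrow> f y"
  shows "(\<lambda>n. halfline_conv (u n) x) \<longlonglongrightarrow> halfline_conv f x"
proof -
  have [measurable]: "f \<in> borel_measurable borel" "\<And>n. u n \<in> borel_measurable borel"
    using u f by (auto simp: between_def)
  have "(\<lambda>n. conv (u n) x) \<longlonglongrightarrow> conv f x"
    unfolding conv_def
  proof (rule integral_dominated_convergence)
    show "integrable lborel (\<lambda>y. J (x - y) * (\<bar>x\<bar> + d + d))"
      using integrable_reflect by simp
    show "AE y in lborel. norm (J (x - y) * u n y) \<le> J (x - y) * (\<bar>x\<bar> + d + d)" for n
      using kernel_mult_bound[OF between_growth[OF u[of n]], of x] by (intro AE_I2) simp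
    show "AE y in lborel. (\<lambda>n. J (x - y) * u n y) \<longlonglongrightarrow> J (x - y) * f y"
      by (intro AE_I2 tendsto_mult tendsto_const lim)
  qed measurable
  then show ?thesis by (simp add: halfline_conv_def)
qed

theorem halfline_conv_fixed_point: "\<exists>f. between f \<and> halfline_conv f = f"
proof -
  define u where "u n = (halfline_conv ^^ n) lower" for n
  have u_Suc: "u (Suc n) = halfline_conv (u n)" for n by (simp add: u_def)
  have u: "between (u n)" for n
    by (induction n) (simp_all add: u_def between_lower between_halfline_conv)
  have step: "u n x \<le> u (Suc n) x" for n x
  proof (induction n arbitrary: x)
    case 0
    then show ?case using u[of "Suc 0"] by (simp add: between_def u_def)
  next
    case (Suc n)
    then show ?case using halfline_conv_mono[OF u u Suc.IH] by (simp only: u_Suc)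
  qed
  have u_bounds: "lower x \<le> u n x" "u n x \<le> upper x" for n x
    using u[of n] by (auto simp: between_def)
  define f where "f x = (SUP n. u n x)" for x
  have lim: "(\<lambda>n. u n x) \<longlonglongrightarrow> f x" for x
    unfolding f_def
    by (rule LIMSEQ_incseq_SUP) (auto intro: bdd_aboveI2 u_bounds incseq_SucI step)
  have f: "between f"
    unfolding between_def
  proof (intro conjI allI)
    show "f \<in> borel_measurable borel"
      by (rule borel_measurable_LIMSEQ_real[OF lim]) (use u in \<open>simp add: between_def\<close>)
    show "lower x \<le> f x" "f x \<le> upper x" for x
      by (rule LIMSEQ_le_const[OF lim] LIMSEQ_le_const2[OF lim], use u_bounds in blast)+
  qed
  have "halfline_conv f x = f x" for x
  proof (rule LIMSEQ_unique)
    show "(\<lambda>n. u (Suc n) x) \<longlonglongrightarrow> halfline_conv f x"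
      using halfline_conv_tendsto[OF u f lim] by (simp add: u_Suc)
    show "(\<lambda>n. u (Suc n) x) \<longlonglongrightarrow> f x"
      using lim by (rule LIMSEQ_Suc)
  qed
  with f show ?thesis by blast
qed

section \<open>The stationary problem\<close>

text \<open>
  For \<open>x \<ge> 0\<close> the restriction to \<open>y > -d\<close> cuts off only points with \<open>x - y \<ge> d\<close>, where the kernel
  vanishes.
\<close>

lemma has_integral_on_domain:
  assumes f: "between f" and "x \<ge> 0"
  shows "integrable (lebesgue_on {-d<..}) (\<lambda>y. J (x - y) * f y)"
    and "conv_on {-d<..} J f x = conv f x"
proof -
  have [measurable]: "f \<in> borel_measurable borel" using f by (simp add: between_def)
  have ind: "indicator {-d<..} y *\<^sub>R (J (x - y) * f y) = J (x - y) * f y" for y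
    using support[of "x - y"] \<open>x \<ge> 0\<close> by (cases "y > -d") auto
  have "integrable lborel (\<lambda>y. J (x - y) * f y)"
    by (rule integrable_conv[OF _ between_growth[OF f]]) measurable
  then have "integrable lebesgue (\<lambda>y. J (x - y) * f y)"
    by (simp add: integrable_completion)
  then show "integrable (lebesgue_on {-d<..}) (\<lambda>y. J (x - y) * f y)"
    by (subst integrable_restrict_space) (simp_all only: ind, simp_all)
  have "conv_on {-d<..} J f x = (LINT y|lebesgue. J (x - y) * f y)"
    unfolding conv_on_def by (subst integral_restrict_space) (simp_all only: ind, simp_all)
  then show "conv_on {-d<..} J f x = conv f x"
    by (simp add: conv_def integral_completion)
qed

lemma stationary_solution_of_fixed_point:
  assumes f: "between f" and fixed: "halfline_conv f = f"
  shows "stationary_solution d J f"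
proof -
  have [measurable]: "f \<in> borel_measurable borel" using f by (simp add: between_def)
  have meas: "g \<in> borel_measurable (lebesgue_on S)" if "g \<in> borel_measurable borel" for g :: "real \<Rightarrow> real" and S
    using that by (intro measurable_restrict_space1 measurable_completion) simp
  have eq: "conv f x = f x" if "x \<ge> 0" for x
    using fun_cong[OF fixed, of x] that by (simp add: halfline_conv_def)
  have zero: "f x = 0" if "x < 0" for x
    using fun_cong[OF fixed, of x] that by (simp add: halfline_conv_def)
  have "\<bar>f x - x\<bar> \<le> d" if "x > 0" for x
    using f that unfolding between_def lower_def upper_def
    by (smt (verit, best))
  then have "AE x in lebesgue_on {0<..}. \<bar>f x - x\<bar> \<le> d"
    by (intro AE_I2) (simp add: space_restrict_space)
  then have "Linfty {0<..} (\<lambda>x. f x - x)"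
    unfolding Linfty_def by (intro conjI meas exI) measurable
  then show ?thesis
    unfolding stationary_solution_def using meas[of f] has_integral_on_domain[OF f] eq zero by simp
qed

end

theorem proposition2p1:
  fixes J :: "real \<Rightarrow> real" and d :: real
  assumes "d > 0"
    and "\<And>z. J z \<ge> 0"
    and "smooth J"
    and "\<And>z. J (- z) = J z"
    and "integrable lebesgue J"
    and "integral\<^sup>L lebesgue J = 1"
    and "\<And>z. \<bar>z\<bar> \<ge> d \<Longrightarrow> J z = 0"
  shows "\<exists>\<phi>. stationary_solution d J \<phi> \<and> (\<forall>x\<ge>0. x \<le> \<phi> x \<and> \<phi> x \<le> x + d)"
proof -
  have "((deriv ^^ 0) J) differentiable_on UNIV"
    using assms(3) unfolding smooth_def by blast
  then have "continuous_on UNIV J"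
    by (simp add: differentiable_imp_continuous_on)
  then have [measurable]: "J \<in> borel_measurable borel"
    by (rule borel_measurable_continuous_onI)
  interpret symmetric_kernel J d
    using assms by unfold_locales (auto simp: integrable_completion integral_completion)
  obtain f where f: "between f" "halfline_conv f = f"
    using halfline_conv_fixed_point by blast
  have "x \<le> f x \<and> f x \<le> x + d" if "x \<ge> 0" for x
  proof -
    have "lower x \<le> f x" "f x \<le> upper x"
      using f(1) by (auto simp: between_def)
    then show ?thesis using that by (simp add: lower_def upper_def)
  qed
  then show ?thesis
    using stationary_solution_of_fixed_point[OF f] by (intro exI[of _ f]) simp
qed

end
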